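(* Let $T$ be a signed tree with a mismatched vertex $u$ and let $\Gamma$ be a signed graph of order $n$ (disjoint from $T$). Then for each integer $k$ with $1\le k\le n$, and for every $k$-joining graph $T(u)\odot^{k}\Gamma$ of $T$ and $\Gamma$ with respect to $u$, $$\eta(T(u)\odot^{k}\Gamma)=\eta(T-u)+\eta(\Gamma+u)=\eta(T)+\eta(\Gamma+u)-1,$$ where $\Gamma+u$ is the subgraph of $T(u)\odot^{k}\Gamma$ induced by the vertices of $\Gamma$ and $u$.
   Context: A signed graph $\Gamma=(G,\sigma)$ consists of a finite simple graph $G=(V,E)$ (its underlying graph) and a map $\sigma:E\to\{+,-\}$. Its adjacency matrix is $A(\Gamma)=(a_{ij}^\sigma)$ with $a_{ij}^\sigma=\sigma(v_iv_j)a_{ij}$ (i.e. $\pm1$ according to the sign of the edge $v_iv_j$, and $0$ if $v_i,v_j$ are not adjacent), where $(a_{ij})$ is the adjacency matrix of $G$. The nullity $\eta(\Gamma)$ is the multiplicity of the eigenvalue $0$ of $A(\Gamma)$; the empty graph has nullity $0$. The order is the number of vertices. A signed tree is a signed graph whose underlying graph is a tree. $T-u$ denotes the signed graph obtained from $T$ by removing $u$ and all signed edges incident to it. Matched/mismatched: for a signed tree $T$ on at least two vertices, a vertex $v$ of $T$ is mismatched in $T$ if there exists a maximum (cardinality) matching of $T$ that does not cover $v$; otherwise $v$ is matched in $T$. If a tree consists of only one vertex, this vertex is considered mismatched. $k$-joining graph: let $\Gamma_1$ be a signed graph containing a vertex $u$ and let $\Gamma_2$ be a signed graph of order $n$ disjoint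 from $\Gamma_1$. For $1\le k\le n$, a $k$-joining graph of $\Gamma_1$ and $\Gamma_2$ with respect to $u$, denoted $\Gamma_1(u)\odot^k\Gamma_2$, is obtained from $\Gamma_1\cup\Gamma_2$ by joining $u$ and arbitrary $k$ vertices of $\Gamma_2$ with signed edges (of arbitrary signs). *)

theory Defs
  imports "Graph_Theory.Digraph_Component" "Jordan_Normal_Form.Char_Poly"
begin

text \<open>
  A finite simple graph is a \<^locale>\<open>pair_graph\<close>: finite, loop-free, with a symmetric set of arcs.
  An undirected edge is the two-element set of the ends of an arc; signs are attached to these sets,
  so the two arcs of an edge carry the same sign. Values of the sign map outside the edge set are
  irrelevant.
\<close>

datatype edge_sign = Pos | Neg

fun sign_val :: "edge_sign \<Rightarrow> real" where
  "sign_val Pos = 1"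
| "sign_val Neg = -1"

record 'a sgraph =
  underlying :: "'a pair_pre_digraph"
  esign :: "'a set \<Rightarrow> edge_sign"

definition signed_graph :: "'a sgraph \<Rightarrow> bool" where
  "signed_graph \<Gamma> \<longleftrightarrow> pair_graph (underlying \<Gamma>)"

abbreviation vertices :: "'a sgraph \<Rightarrow> 'a set" where
  "vertices \<Gamma> \<equiv> pverts (underlying \<Gamma>)"

definition adjacent :: "'a sgraph \<Rightarrow> 'a \<Rightarrow> 'a \<Rightarrow> bool" where
  "adjacent \<Gamma> x y \<longleftrightarrow> (x, y) \<in> parcs (underlying \<Gamma>)"

definition edges :: "'a sgraph \<Rightarrow> 'a set set" where
  "edges \<Gamma> = {{x, y} | x y. adjacent \<Gamma> x y}"

definition sg_order :: "'a sgraph \<Rightarrow> nat" where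
  "sg_order \<Gamma> = card (vertices \<Gamma>)"

definition del_vertex :: "'a sgraph \<Rightarrow> 'a \<Rightarrow> 'a sgraph" where
  "del_vertex \<Gamma> u =
     \<lparr> underlying = \<lparr> pverts = vertices \<Gamma> - {u},
                      parcs = {e \<in> parcs (underlying \<Gamma>). fst e \<noteq> u \<and> snd e \<noteq> u} \<rparr>,
       esign = esign \<Gamma> \<rparr>"

definition induced :: "'a sgraph \<Rightarrow> 'a set \<Rightarrow> 'a sgraph" where
  "induced \<Gamma> S =
     \<lparr> underlying = \<lparr> pverts = vertices \<Gamma> \<inter> S,
                      parcs = {e \<in> parcs (underlying \<Gamma>). fst e \<in> S \<and> snd e \<in> S} \<rparr>,
       esign = esign \<Gamma> \<rparr>"


subsection \<open>Adjacency matrix and nullity\<close>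

definition adj_matrix :: "'a sgraph \<Rightarrow> 'a list \<Rightarrow> real mat" where
  "adj_matrix \<Gamma> vs = mat (length vs) (length vs) (\<lambda>(i, j).
     if adjacent \<Gamma> (vs ! i) (vs ! j) then sign_val (esign \<Gamma> {vs ! i, vs ! j}) else 0)"

definition vertex_list :: "'a sgraph \<Rightarrow> 'a list" where
  "vertex_list \<Gamma> = (SOME vs. distinct vs \<and> set vs = vertices \<Gamma>)"

text \<open>
  The multiplicity of the eigenvalue 0 is its multiplicity as a root of the characteristic
  polynomial. It does not depend on the chosen enumeration of the vertices; for the empty graph the
  characteristic polynomial is 1 and the nullity is 0.
\<close>

definition nullity :: "'a sgraph \<Rightarrow> nat" where
  "nullity \<Gamma> = Polynomial.order 0 (char_poly (adj_matrix \<Gamma> (vertex_list \<Gamma>)))"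


subsection \<open>Signed trees and mismatched vertices\<close>

text \<open>
  In a symmetric digraph, traversing an edge back and forth is a directed cycle of length 2. Hence
  \<^const>\<open>forest\<close> and \<^const>\<open>tree\<close> do not describe undirected forests and
  trees here, and only directed cycles of length at least 3, that is, the cycles of the undirected
  graph, are excluded. Connectedness includes that there is at least one vertex.
\<close>

definition signed_tree :: "'a sgraph \<Rightarrow> bool" where
  "signed_tree T \<longleftrightarrow> signed_graph T
     \<and> Digraph_Component.connected (with_proj (underlying T))
     \<and> \<not> (\<exists>p. pre_digraph.cycle (with_proj (underlying T)) p \<and> length p \<ge> 3)"

definition matching :: "'a sgraph \<Rightarrow> 'a set set \<Rightarrow> bool" where
  "matching \<Gamma> M \<longleftrightarrow> M \<subseteq> edges \<Gamma> \<and> (\<forall>e\<in>M. \<forall>f\<in>M. e \<noteq> f \<longrightarrow> e \<inter> f = {})"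

definition maximum_matching :: "'a sgraph \<Rightarrow> 'a set set \<Rightarrow> bool" where
  "maximum_matching \<Gamma> M \<longleftrightarrow> matching \<Gamma> M \<and> (\<forall>N. matching \<Gamma> N \<longrightarrow> card N \<le> card M)"

definition mismatched :: "'a sgraph \<Rightarrow> 'a \<Rightarrow> bool" where
  "mismatched T v \<longleftrightarrow> v \<in> vertices T
     \<and> (sg_order T = 1 \<or> (\<exists>M. maximum_matching T M \<and> v \<notin> \<Union>M))"


subsection \<open>Joining graphs\<close>

text \<open>
  \<open>k_joining k \<Gamma>\<^sub>1 u \<Gamma>\<^sub>2 \<Delta>\<close> says that \<open>\<Delta>\<close> is one of the \<open>k\<close>-joining graphs
  of \<open>\<Gamma>\<^sub>1\<close> and \<open>\<Gamma>\<^sub>2\<close> with respect to \<open>u\<close>; it is meant for signed graphs on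
  disjoint vertex sets with \<open>u\<close> a vertex of \<open>\<Gamma>\<^sub>1\<close>. The signs of the new edges are
  unconstrained.
\<close>

definition k_joining :: "nat \<Rightarrow> 'a sgraph \<Rightarrow> 'a \<Rightarrow> 'a sgraph \<Rightarrow> 'a sgraph \<Rightarrow> bool" where
  "k_joining k \<Gamma>\<^sub>1 u \<Gamma>\<^sub>2 \<Delta> \<longleftrightarrow> (\<exists>S. S \<subseteq> vertices \<Gamma>\<^sub>2 \<and> card S = k
     \<and> vertices \<Delta> = vertices \<Gamma>\<^sub>1 \<union> vertices \<Gamma>\<^sub>2
     \<and> parcs (underlying \<Delta>) = parcs (underlying \<Gamma>\<^sub>1) \<union> parcs (underlying \<Gamma>\<^sub>2)
         \<union> {u} \<times> S \<union> S \<times> {u}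
     \<and> (\<forall>e\<in>edges \<Gamma>\<^sub>1. esign \<Delta> e = esign \<Gamma>\<^sub>1 e)
     \<and> (\<forall>e\<in>edges \<Gamma>\<^sub>2. esign \<Delta> e = esign \<Gamma>\<^sub>2 e))"

end

theory Submission
  imports Defs
    "Jordan_Normal_Form.Jordan_Normal_Form_Existence"
    "Jordan_Normal_Form.Jordan_Normal_Form_Uniqueness"
begin

text \<open>
  Suppose that the adjacency matrix of \<open>T\<close> has a kernel vector \<open>x\<close> with \<open>x u = 1\<close>. Regard the adjacency
  matrix of the joining graph as a symmetric bilinear form and replace the basis vector of \<open>u\<close> by \<open>x\<close>.
  Since \<open>x\<close> is in the kernel for \<open>T\<close>, the new vector is orthogonal to \<open>T\<close>, while it pairs with the vertices
  of \<open>\<Gamma>\<close> as \<open>u\<close> did. So the form is congruent to the orthogonal sum of those of \<open>T - u\<close> and \<open>\<Gamma> + u\<close>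
  (\<open>order_zero_fun_mat_split_at_kernel_vector\<close>). Congruence preserves the multiplicity of the eigenvalue 0 of
  a real symmetric matrix, because this multiplicity is the dimension of the kernel
  (\<open>order_zero_char_poly_congruent\<close>). This gives the first equation; for empty \<open>\<Gamma>\<close> it reads
  \<open>\<eta>(T) = \<eta>(T - u) + 1\<close>, which gives the second.

  It remains to find \<open>x\<close> for a mismatched vertex \<open>u\<close>. More is true: in a forest, a vertex \<open>u\<close> has a nonzero
  entry in some kernel vector if and only if some maximum matching misses \<open>u\<close>
  (\<open>supported_iff_exposable\<close>). Both conditions hold at \<open>u\<close> exactly when they fail, after the removal of \<open>u\<close>,
  at each neighbour of \<open>u\<close>, and the claim follows by induction. For matchings this recursion holds
  in every finite graph without loops. For kernel vectors it uses that every edge of a forest is a bridge,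
  so that a neighbour can be separated from the others, and that a forest is bipartite, so that the
  equation at \<open>u\<close> can be satisfied independently of the others.
\<close>

section \<open>The multiplicity of the eigenvalue 0 of a real symmetric matrix\<close>

text \<open>
  If \<open>A (A v) = 0\<close> for a real symmetric \<open>A\<close>, then \<open>|A v|\<^sup>2 = (A (A v)) \<bullet> cnj v = 0\<close>, hence \<open>A v = 0\<close>.
  The vectors are complex because the Jordan form used next lives over the complex numbers.
\<close>

lemma mat_kernel_square_real_symmetric:
  fixes B :: "real mat"
  assumes B: "B \<in> carrier_mat n n" and sym: "transpose_mat B = B"
  defines "A \<equiv> map_mat complex_of_real B"
  shows "mat_kernel (A * A) = mat_kernel A"
proof
  have A: "A \<in> carrier_mat n n" using B by (simp add: A_def)
  have AA: "A * A \<in> carrier_mat n n" using A by simp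
  have At: "transpose_mat A = A" using sym unfolding A_def by (metis map_mat_transpose)
  have conj: "conjugate (A *\<^sub>v v) = A *\<^sub>v conjugate v" if "v \<in> carrier_vec n" for v
    using that B by (intro eq_vecI) (auto simp: A_def scalar_prod_def)
  show "mat_kernel A \<subseteq> mat_kernel (A * A)"
    using mat_kernel_mult_subset[OF A A] .
  show "mat_kernel (A * A) \<subseteq> mat_kernel A"
  proof
    fix v assume "v \<in> mat_kernel (A * A)"
    then have v: "v \<in> carrier_vec n" and "A * A *\<^sub>v v = 0\<^sub>v n"
      using mat_kernelD[OF AA] by auto
    then have AAv: "A *\<^sub>v (A *\<^sub>v v) = 0\<^sub>v n" using A by (simp add: assoc_mult_mat_vec)
    have Av: "A *\<^sub>v v \<in> carrier_vec n" using A v by simp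
    have "(A *\<^sub>v v) \<bullet>c (A *\<^sub>v v) = (A *\<^sub>v v) \<bullet> (A *\<^sub>v conjugate v)" using conj[OF v] by simp
    also have "\<dots> = (transpose_mat A *\<^sub>v (A *\<^sub>v v)) \<bullet> conjugate v"
      using transpose_vec_mult_scalar[OF A _ Av, of "conjugate v"] v by simp
    also have "\<dots> = 0" using AAv At v by simp
    finally have "A *\<^sub>v v = 0\<^sub>v n" using conjugate_square_eq_0_vec[OF Av] by simp
    then show "v \<in> mat_kernel A" using mat_kernelI[OF A v] by simp
  qed
qed

text \<open>
  The kernels of \<open>A\<close> and of \<open>A\<^sup>2\<close> coincide. Their dimensions are the sums of \<open>min 1 s\<close> and of
  \<open>min 2 s\<close> over the sizes \<open>s\<close> of the Jordan blocks for the eigenvalue 0, so all of these blocks have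
  size 1, and their total size, the algebraic multiplicity, is their number, the geometric one.
\<close>

lemma order_zero_char_poly_real_symmetric:
  fixes B :: "real mat"
  assumes B: "B \<in> carrier_mat n n" and sym: "transpose_mat B = B"
  shows "Polynomial.order 0 (char_poly B) = kernel.dim n (map_mat complex_of_real B)"
proof -
  define A where "A = map_mat complex_of_real B"
  have A: "A \<in> carrier_mat n n" using B by (simp add: A_def)
  interpret of_real: map_poly_inj_idom_divide_hom complex_of_real by unfold_locales auto
  obtain as where "char_poly A = (\<Prod>a\<leftarrow>as. [:- a, 1:])"
    using char_poly_factorized[OF A] by auto
  then obtain n_as where jnf: "jordan_nf A n_as" using jordan_nf_exists[OF A] by blast
  have char: "char_matrix A 0 = A" using A by (auto simp: char_matrix_def)
  have pow1: "A ^\<^sub>m 1 = A" using A by simp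
  have pow2: "A ^\<^sub>m 2 = A * A" using A by (simp add: numeral_2_eq_2)
  have dim: "kernel.dim n A = dim_gen_eigenspace A 0 k" if "k = 1 \<or> k = 2" for k
    using that A unfolding dim_gen_eigenspace_def char kernel_dim_def
    using mat_kernel_square_real_symmetric[OF B sym, folded A_def] pow1 pow2 by auto
  let ?sizes = "map fst [(n, e)\<leftarrow>n_as. e = 0]"
  have "0 \<notin> fst ` set n_as" using jnf by (simp add: jordan_nf_def)
  then have pos: "0 \<notin> set ?sizes" by force
  have "sum_list (map (min 2) ?sizes) = sum_list (map (min 1) ?sizes)"
    using dim[of 1] dim[of 2] unfolding dim_gen_eigenspace[OF jnf] by simp
  moreover have "sum_list xs = sum_list (map (min 1) xs)"
    if "0 \<notin> set xs" "sum_list (map (min 2) xs) = sum_list (map (min 1) xs)" for xs :: "nat list"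
    using that
  proof (induction xs)
    case (Cons a xs)
    have "sum_list (map (min 1) xs) \<le> sum_list (map (min 2) xs)"
      by (rule sum_list_mono) auto
    moreover have "min 2 a + sum_list (map (min 2) xs) = min 1 a + sum_list (map (min 1) xs)"
      using Cons.prems by simp
    moreover have "a \<ge> 1" using Cons.prems by (cases a) auto
    ultimately have "a = 1" "sum_list (map (min 2) xs) = sum_list (map (min 1) xs)"
      by linarith+
    then show ?case using Cons by simp
  qed simp
  ultimately have "sum_list ?sizes = sum_list (map (min 1) ?sizes)" using pos by blast
  then have "Polynomial.order 0 (char_poly A) = kernel.dim n A"
    unfolding jordan_nf_order[OF jnf] using dim[of 1] dim_gen_eigenspace[OF jnf, of 0 1]
    by (simp add: case_prod_unfold)
  moreover have "char_poly A = map_poly complex_of_real (char_poly B)"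
    unfolding A_def by (rule of_real_hom.char_poly_hom[OF B])
  moreover have "Polynomial.order 0 (map_poly complex_of_real (char_poly B)) = Polynomial.order 0 (char_poly B)"
    using of_real.order_hom[of 0 "char_poly B"] by simp
  ultimately show ?thesis unfolding A_def by simp
qed

text \<open>
  A congruence is in general not a similarity and changes the characteristic polynomial. It does
  preserve the dimension of the kernel, which for symmetric matrices is the multiplicity of 0.
\<close>

lemma order_zero_char_poly_congruent:
  fixes B P Q :: "real mat"
  assumes B: "B \<in> carrier_mat n n" and P: "P \<in> carrier_mat n n" and Q: "Q \<in> carrier_mat n n"
    and sym: "transpose_mat B = B" and PQ: "P * Q = 1\<^sub>m n"
  shows "Polynomial.order 0 (char_poly (transpose_mat P * B * P)) = Polynomial.order 0 (char_poly B)"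
proof -
  let ?c = "map_mat complex_of_real"
  have Pt: "transpose_mat P \<in> carrier_mat n n" and Qt: "transpose_mat Q \<in> carrier_mat n n"
    using P Q by auto
  have QPt: "transpose_mat Q * transpose_mat P = 1\<^sub>m n"
    using transpose_mult[OF P Q] PQ by simp
  have sym': "transpose_mat (transpose_mat P * B * P) = transpose_mat P * B * P"
    using transpose_mult[OF mult_carrier_mat[OF Pt B] P] transpose_mult[OF Pt B] sym
    by (simp add: assoc_mult_mat[OF Pt B P])
  have c: "?c X \<in> carrier_mat n n" if "X \<in> carrier_mat n n" for X using that by simp
  have mult: "?c (X * Y) = ?c X * ?c Y" if "X \<in> carrier_mat n n" "Y \<in> carrier_mat n n" for X Y
    using of_real_hom.mat_hom_mult[OF that] .
  have one: "?c (1\<^sub>m n) = 1\<^sub>m n" by (rule of_real_hom.mat_hom_one)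
  have "Polynomial.order 0 (char_poly (transpose_mat P * B * P))
      = kernel.dim n (?c (transpose_mat P) * ?c B * ?c P)"
    using order_zero_char_poly_real_symmetric[OF _ sym', of n] Pt B P by (simp add: mult)
  also have "\<dots> = kernel.dim n (?c (transpose_mat P) * ?c B)"
    by (rule mat_kernel_dim_mult_eq_right[of _ n n _ "?c Q"])
      (use Pt B P Q PQ mult one in \<open>auto simp flip: mult\<close>)
  also have "mat_kernel (?c (transpose_mat P) * ?c B) = mat_kernel (?c B)"
    by (rule mat_kernel_mult_eq[OF c[OF B] c[OF Pt] c[OF Qt]])
      (use QPt mult[OF Qt Pt] one in simp)
  also have "kernel.dim n (?c B) = Polynomial.order 0 (char_poly B)"
    using order_zero_char_poly_real_symmetric[OF B sym] by simp
  finally show ?thesis .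
qed

lemma char_poly_four_block_diag:
  fixes B D :: "real mat"
  assumes B: "B \<in> carrier_mat n n" and D: "D \<in> carrier_mat m m"
  shows "char_poly (four_block_mat B (0\<^sub>m n m) (0\<^sub>m m n) D) = char_poly B * char_poly D"
proof -
  have "char_poly_matrix (four_block_mat B (0\<^sub>m n m) (0\<^sub>m m n) D)
      = four_block_mat (char_poly_matrix B) (0\<^sub>m n m) (0\<^sub>m m n) (char_poly_matrix D)"
    using B D by (intro eq_matI) (auto simp: char_poly_matrix_def)
  then show ?thesis
    unfolding char_poly_def using B D
    by (simp add: det_four_block_mat_upper_right_zero[of _ n _ m])
qed

section \<open>Matrices of functions and splitting at a kernel vector\<close>

text \<open>
  Rows and columns are labelled by vertices rather than by numbers, so that a change of basis can be
  described by a function of two vertices and matrix products become sums over vertex sets.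
\<close>

definition fun_mat :: "('a \<Rightarrow> 'b \<Rightarrow> real) \<Rightarrow> 'a list \<Rightarrow> 'b list \<Rightarrow> real mat" where
  "fun_mat f xs ys = mat (length xs) (length ys) (\<lambda>(i, j). f (xs ! i) (ys ! j))"

lemma fun_mat_carrier [simp]: "fun_mat f xs ys \<in> carrier_mat (length xs) (length ys)"
  by (simp add: fun_mat_def)

lemma fun_mat_cong:
  assumes "\<And>a b. a \<in> set xs \<Longrightarrow> b \<in> set ys \<Longrightarrow> f a b = g a b"
  shows "fun_mat f xs ys = fun_mat g xs ys"
  using assms by (intro eq_matI) (auto simp: fun_mat_def)

lemma transpose_fun_mat: "transpose_mat (fun_mat f xs ys) = fun_mat (\<lambda>a b. f b a) ys xs"
  by (intro eq_matI) (auto simp: fun_mat_def)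

lemma fun_mat_mult:
  assumes "distinct ys"
  shows "fun_mat f xs ys * fun_mat g ys zs = fun_mat (\<lambda>a c. \<Sum>b\<in>set ys. f a b * g b c) xs zs"
proof (intro eq_matI)
  fix i j
  assume ij: "i < dim_row (fun_mat (\<lambda>a c. \<Sum>b\<in>set ys. f a b * g b c) xs zs)"
    "j < dim_col (fun_mat (\<lambda>a c. \<Sum>b\<in>set ys. f a b * g b c) xs zs)"
  have "(\<Sum>b\<in>set ys. f (xs ! i) b * g b (zs ! j))
      = (\<Sum>k = 0..<length ys. f (xs ! i) (ys ! k) * g (ys ! k) (zs ! j))"
    using sum.reindex_bij_betw[OF bij_betw_nth[OF assms, of "{0..<length ys}" "set ys"],
        of "\<lambda>b. f (xs ! i) b * g b (zs ! j)"] by (simp add: atLeast0LessThan)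
  then show "(fun_mat f xs ys * fun_mat g ys zs) $$ (i, j)
      = fun_mat (\<lambda>a c. \<Sum>b\<in>set ys. f a b * g b c) xs zs $$ (i, j)"
    using ij by (simp add: fun_mat_def scalar_prod_def)
qed (auto simp: fun_mat_def)

lemma fun_mat_delta:
  assumes "distinct xs"
  shows "fun_mat (\<lambda>a b. if a = b then 1 else 0) xs xs = 1\<^sub>m (length xs)"
  using assms by (intro eq_matI) (auto simp: fun_mat_def nth_eq_iff_index_eq)

text \<open>
  Congruence in terms of labels: \<open>p\<close> is the base change, \<open>q\<close> its inverse, and \<open>W'\<close> is the transformed
  bilinear form. The two enumerations of \<open>V\<close> are independent, so that the case of an identical base
  change shows that the order of the vertices does not matter.
\<close>

lemma order_zero_fun_mat_congruent:
  assumes vs: "distinct vs" "set vs = V" and ws: "distinct ws" "set ws = V"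
    and sym: "\<And>a b. a \<in> V \<Longrightarrow> b \<in> V \<Longrightarrow> W a b = W b a"
    and inv: "\<And>a c. a \<in> V \<Longrightarrow> c \<in> V \<Longrightarrow> (\<Sum>b\<in>V. p a b * q b c) = (if a = c then 1 else 0)"
    and cong: "\<And>a d. a \<in> V \<Longrightarrow> d \<in> V \<Longrightarrow> (\<Sum>c\<in>V. (\<Sum>b\<in>V. p b a * W b c) * p c d) = W' a d"
  shows "Polynomial.order 0 (char_poly (fun_mat W' ws ws)) = Polynomial.order 0 (char_poly (fun_mat W vs vs))"
proof -
  have len: "length ws = length vs" using vs ws by (metis distinct_card)
  let ?P = "fun_mat p vs ws" and ?Q = "fun_mat q ws vs"
  have "transpose_mat ?P * fun_mat W vs vs * ?P
      = fun_mat (\<lambda>a d. \<Sum>c\<in>V. (\<Sum>b\<in>V. p b a * W b c) * p c d) ws ws"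
    by (simp add: transpose_fun_mat fun_mat_mult vs)
  also have "\<dots> = fun_mat W' ws ws"
    using cong ws by (intro fun_mat_cong) auto
  finally have eq: "transpose_mat ?P * fun_mat W vs vs * ?P = fun_mat W' ws ws" .
  have "?P * ?Q = 1\<^sub>m (length vs)"
    unfolding fun_mat_mult[OF ws(1)] fun_mat_delta[OF vs(1), symmetric]
    using inv vs ws by (intro fun_mat_cong) auto
  moreover have "transpose_mat (fun_mat W vs vs) = fun_mat W vs vs"
    unfolding transpose_fun_mat using sym vs by (intro fun_mat_cong) auto
  ultimately show ?thesis
    using order_zero_char_poly_congruent[of "fun_mat W vs vs" "length vs" ?P ?Q] eq
      fun_mat_carrier[of p vs ws] fun_mat_carrier[of q ws vs] unfolding len by simp
qed

lemma order_zero_fun_mat_reorder: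
  assumes "distinct vs" "distinct ws" "set vs = set ws"
    and sym: "\<And>a b. a \<in> set vs \<Longrightarrow> b \<in> set vs \<Longrightarrow> W a b = W b a"
  shows "Polynomial.order 0 (char_poly (fun_mat W ws ws)) = Polynomial.order 0 (char_poly (fun_mat W vs vs))"
proof (rule order_zero_fun_mat_congruent[where V = "set vs"])
  let ?d = "\<lambda>a b. if a = b then 1 else (0::real)"
  show "(\<Sum>b\<in>set vs. ?d a b * ?d b c) = ?d a c" if "a \<in> set vs" "c \<in> set vs" for a c
    using that by (simp add: if_distrib[of "\<lambda>x. x * _"] cong: if_cong)
  show "(\<Sum>c\<in>set vs. (\<Sum>b\<in>set vs. ?d b a * W b c) * ?d c d) = W a d"
    if "a \<in> set vs" "d \<in> set vs" for a d
    using that by (simp add: if_distrib[of "\<lambda>x. x * _"] if_distrib[of "\<lambda>x. _ * x"] cong: if_cong)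
qed (use assms in auto)


lemma fun_mat_append:
  "fun_mat f (xs @ ys) (xs @ ys)
    = four_block_mat (fun_mat f xs xs) (fun_mat f xs ys) (fun_mat f ys xs) (fun_mat f ys ys)"
  by (intro eq_matI) (auto simp: fun_mat_def nth_append)

lemma fun_mat_zero:
  assumes "\<And>a b. a \<in> set xs \<Longrightarrow> b \<in> set ys \<Longrightarrow> f a b = 0"
  shows "fun_mat f xs ys = 0\<^sub>m (length xs) (length ys)"
  using assms by (intro eq_matI) (auto simp: fun_mat_def)

lemma order_zero_fun_mat_append:
  assumes "\<And>a b. a \<in> set xs \<Longrightarrow> b \<in> set ys \<Longrightarrow> f a b = 0 \<and> f b a = 0"
  shows "Polynomial.order 0 (char_poly (fun_mat f (xs @ ys) (xs @ ys)))
    = Polynomial.order 0 (char_poly (fun_mat f xs xs)) + Polynomial.order 0 (char_poly (fun_mat f ys ys))"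
proof -
  have "char_poly (fun_mat f (xs @ ys) (xs @ ys)) = char_poly (fun_mat f xs xs) * char_poly (fun_mat f ys ys)"
    unfolding fun_mat_append
    using assms by (simp add: fun_mat_zero char_poly_four_block_diag[OF fun_mat_carrier fun_mat_carrier])
  moreover have "char_poly (fun_mat f zs zs) \<noteq> 0" for zs
    using degree_monic_char_poly[OF fun_mat_carrier[of f zs zs]] by auto
  ultimately show ?thesis by (simp add: order_mult)
qed

lemma order_zero_fun_mat_singleton:
  assumes "W u u = 0"
  shows "Polynomial.order 0 (char_poly (fun_mat W [u] [u])) = 1"
proof -
  have "char_poly (fun_mat W [u] [u]) = [:0, 1:]"
    using assms by (simp add: char_poly_defs fun_mat_def det_single)
  then show ?thesis using order_linear_power[of 0 0 1] by simp
qed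

text \<open>
  Scale the kernel vector \<open>x\<close> of the block on \<open>ts\<close> and \<open>u\<close> so that its value at \<open>u\<close> is 1, extend it by 0,
  and replace the basis vector of \<open>u\<close> by it. With respect to the bilinear form \<open>W\<close> the new basis vector
  is orthogonal to itself and to \<open>ts\<close>; its products with \<open>gs\<close> are those of \<open>u\<close>, because \<open>ts\<close> and \<open>gs\<close>
  are orthogonal to each other. So in the new basis the form is the orthogonal sum of its
  restrictions to \<open>ts\<close> and to \<open>u # gs\<close>.
\<close>

lemma order_zero_fun_mat_split_at_kernel_vector:
  assumes dist: "distinct (ts @ u # gs)"
    and sym: "\<And>a b. a \<in> set (ts @ u # gs) \<Longrightarrow> b \<in> set (ts @ u # gs) \<Longrightarrow> W a b = W b a"
    and loop: "W u u = 0"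
    and cross: "\<And>a b. a \<in> set ts \<Longrightarrow> b \<in> set gs \<Longrightarrow> W a b = 0"
    and ker: "\<And>a. a \<in> insert u (set ts) \<Longrightarrow> (\<Sum>b\<in>insert u (set ts). W a b * x b) = 0"
    and xu: "x u \<noteq> 0"
  shows "Polynomial.order 0 (char_poly (fun_mat W (ts @ u # gs) (ts @ u # gs)))
    = Polynomial.order 0 (char_poly (fun_mat W ts ts))
      + Polynomial.order 0 (char_poly (fun_mat W (u # gs) (u # gs)))"
proof -
  let ?vs = "ts @ u # gs"
  let ?V = "set ?vs" and ?T = "insert u (set ts)"
  define y where "y b = (if b \<in> ?T then x b / x u else 0)" for b
  define p where "p b a = (if a = u then y b else if b = a then 1 else 0)" for a b
  define q where "q b a = (if a = u then if b = u then 1 else - y b else if b = a then 1 else 0)" for a b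
  define W' where "W' a b = (if a \<in> set ts \<longleftrightarrow> b \<in> set ts then W a b else 0)" for a b
  have TV: "?T \<subseteq> ?V" by auto
  have yu: "y u = 1" using xu by (simp add: y_def)
  have sum_y: "(\<Sum>b\<in>?V. W a b * y b) = (\<Sum>b\<in>?T. W a b * x b) / x u" for a
  proof -
    have "(\<Sum>b\<in>?V. W a b * y b) = (\<Sum>b\<in>?T. W a b * x b / x u)"
      using TV by (intro sum.mono_neutral_cong_right) (auto simp: y_def)
    then show ?thesis by (simp only: sum_divide_distrib)
  qed
  \<comment> \<open>The products of the new basis vector with the old basis.\<close>
  have row: "(\<Sum>b\<in>?V. W a b * y b) = (if a \<in> ?T then 0 else W a u)" if a: "a \<in> ?V" for a
  proof (cases "a \<in> ?T")
    case True
    then show ?thesis unfolding sum_y using ker by simp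
  next
    case False
    then have "W a b = 0" if "b \<in> set ts" for b using a that cross[of b a] sym[of a b] by auto
    then show ?thesis unfolding sum_y using False xu dist by simp
  qed
  have "Polynomial.order 0 (char_poly (fun_mat W' ?vs ?vs)) = Polynomial.order 0 (char_poly (fun_mat W ?vs ?vs))"
  proof (rule order_zero_fun_mat_congruent[where V = ?V and p = p and q = q, OF dist refl dist refl sym])
    fix a c assume ac: "a \<in> ?V" "c \<in> ?V"
    show "(\<Sum>b\<in>?V. p a b * q b c) = (if a = c then 1 else 0)"
    proof (cases "c = u")
      case False
      then have "(\<Sum>b\<in>?V. p a b * q b c) = (\<Sum>b\<in>?V. if b = c then p a b else 0)"
        by (intro sum.cong) (auto simp: q_def)
      also have "\<dots> = p a c" using ac by simp
      finally show ?thesis using False by (simp add: p_def)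
    next
      case True
      have uV: "u \<in> ?V" by simp
      have "(\<Sum>b\<in>?V. p a b * q b c) = p a u * q u c + (\<Sum>b\<in>?V - {u}. p a b * q b c)"
        using sum.remove[OF _ uV, of "\<lambda>b. p a b * q b c"] by simp
      also have "(\<Sum>b\<in>?V - {u}. p a b * q b c) = (\<Sum>b\<in>?V - {u}. if b = a then - y b else 0)"
        using True by (intro sum.cong) (auto simp: p_def q_def)
      also have "\<dots> = (if a = u then 0 else - y a)" using ac by auto
      finally show ?thesis using True yu by (auto simp: p_def q_def)
    qed
  next
    fix a d assume ad: "a \<in> ?V" "d \<in> ?V"
    \<comment> \<open>\<open>R\<close> is the form after changing the basis in the first argument only.\<close>
    define R where "R c = (if a = u then (if c \<in> ?T then 0 else W c u) else W a c)" for c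
    have "(\<Sum>b\<in>?V. p b a * W b c) = R c" if c: "c \<in> ?V" for c
    proof (cases "a = u")
      case True
      have "(\<Sum>b\<in>?V. p b a * W b c) = (\<Sum>b\<in>?V. W c b * y b)"
        using True sym c by (intro sum.cong) (auto simp: p_def)
      then show ?thesis using row[OF c] True by (simp add: R_def)
    next
      case False
      then have "(\<Sum>b\<in>?V. p b a * W b c) = (\<Sum>b\<in>?V. if b = a then W b c else 0)"
        by (intro sum.cong) (auto simp: p_def)
      then show ?thesis using False ad by (simp add: R_def)
    qed
    then have "(\<Sum>c\<in>?V. (\<Sum>b\<in>?V. p b a * W b c) * p c d) = (\<Sum>c\<in>?V. R c * p c d)"
      by (intro sum.cong) auto
    also have "\<dots> = W' a d"
    proof (cases "d = u")
      case True
      then have "(\<Sum>c\<in>?V. R c * p c d) = (\<Sum>c\<in>?V. R c * y c)" by (simp add: p_def)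
      also have "\<dots> = (if a \<in> ?T then 0 else W a u)"
      proof (cases "a = u")
        case True
        then have "R c * y c = 0" for c by (simp add: R_def y_def)
        then show ?thesis using True by simp
      next
        case False
        then show ?thesis using row[OF ad(1)] by (simp add: R_def)
      qed
      finally show ?thesis using True loop dist by (auto simp: W'_def)
    next
      case False
      then have "(\<Sum>c\<in>?V. R c * p c d) = (\<Sum>c\<in>?V. if c = d then R c else 0)"
        by (intro sum.cong) (auto simp: p_def)
      also have "\<dots> = R d" using ad by simp
      also have "\<dots> = W' a d"
        using False ad dist cross[of a d] cross[of d a] sym[of a d] by (auto simp: R_def W'_def)
      finally show ?thesis .
    qed
    finally show "(\<Sum>c\<in>?V. (\<Sum>b\<in>?V. p b a * W b c) * p c d) = W' a d" .
  qed
  moreover have "Polynomial.order 0 (char_poly (fun_mat W' ?vs ?vs))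
      = Polynomial.order 0 (char_poly (fun_mat W' ts ts))
        + Polynomial.order 0 (char_poly (fun_mat W' (u # gs) (u # gs)))"
    using dist by (intro order_zero_fun_mat_append) (auto simp: W'_def)
  moreover have "fun_mat W' ts ts = fun_mat W ts ts" by (intro fun_mat_cong) (simp add: W'_def)
  moreover have "fun_mat W' (u # gs) (u # gs) = fun_mat W (u # gs) (u # gs)"
    using dist by (intro fun_mat_cong) (auto simp: W'_def)
  ultimately show ?thesis by simp
qed


section \<open>Solvability of linear systems\<close>

text \<open>
  A right-hand side \<open>b\<close> outside the span of the columns is detected by a \<open>y\<close> orthogonal to all columns.
  Add a column \<open>c\<close>. If \<open>c\<close> lies in the old span, the old alternatives for \<open>b\<close> still work. Otherwise
  some \<open>y\<close> orthogonal to the old columns has \<open>y \<bullet> c \<noteq> 0\<close>; subtract from \<open>b\<close> the multiple \<open>t c\<close> that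
  makes it orthogonal to \<open>y\<close>, apply the alternative to \<open>b - t c\<close>, and correct a resulting \<open>y'\<close> by a
  multiple of \<open>y\<close> to make it orthogonal to \<open>c\<close> as well.
\<close>

lemma linear_system_alternative:
  fixes f :: "'a \<Rightarrow> 'b \<Rightarrow> real" and b :: "'a \<Rightarrow> real"
  assumes "finite I" "finite J"
  shows "(\<exists>z. \<forall>i\<in>I. (\<Sum>j\<in>J. f i j * z j) = b i)
    \<or> (\<exists>y. (\<forall>j\<in>J. (\<Sum>i\<in>I. y i * f i j) = 0) \<and> (\<Sum>i\<in>I. y i * b i) \<noteq> 0)"
  using assms(2)
proof (induction J arbitrary: b)
  case empty
  show ?case
  proof (cases "\<forall>i\<in>I. b i = 0")
    case False
    then obtain i where i: "i \<in> I" "b i \<noteq> 0" by auto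
    have "(\<Sum>k\<in>I. (if k = i then 1 else 0) * b k) = b i"
      using i assms(1) by (simp add: if_distrib[of "\<lambda>x. x * _"] cong: if_cong)
    then show ?thesis using i by (intro disjI2 exI[of _ "\<lambda>k. if k = i then 1 else 0"]) simp
  qed simp
next
  case (insert c J)
  let ?col = "\<lambda>i. f i c"
  let ?perp = "\<lambda>y. \<forall>j\<in>J. (\<Sum>i\<in>I. y i * f i j) = 0"
  let ?solves = "\<lambda>z b. \<forall>i\<in>I. (\<Sum>j\<in>J. f i j * z j) = b i"
  have extend: "\<exists>z. \<forall>i\<in>I. (\<Sum>j\<in>insert c J. f i j * z j) = b i"
    if "?solves z (\<lambda>i. b i - t * ?col i)" for z t
  proof -
    have "(\<Sum>j\<in>J. f i j * (if j = c then t else z j)) = (\<Sum>j\<in>J. f i j * z j)" for i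
      using insert.hyps by (intro sum.cong) auto
    then show ?thesis using that insert.hyps
      by (intro exI[of _ "\<lambda>j. if j = c then t else z j"]) (simp add: algebra_simps)
  qed
  consider (sol) z where "?solves z ?col" | (perp) y where "?perp y" "(\<Sum>i\<in>I. y i * ?col i) \<noteq> 0"
    using insert.IH[of ?col] by auto
  then show ?case
  proof cases
    case sol
    consider z' where "?solves z' b" | y where "?perp y" "(\<Sum>i\<in>I. y i * b i) \<noteq> 0"
      using insert.IH[of b] by auto
    then show ?thesis
    proof cases
      case 1
      then show ?thesis using extend[of z' 0] by simp
    next
      case 2
      have "(\<Sum>i\<in>I. y i * ?col i) = (\<Sum>i\<in>I. \<Sum>j\<in>J. y i * f i j * z j)"
        using sol by (intro sum.cong) (auto simp: sum_distrib_left mult.assoc simp flip: sol)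
      also have "\<dots> = (\<Sum>j\<in>J. (\<Sum>i\<in>I. y i * f i j) * z j)"
        unfolding sum_distrib_right by (rule sum.swap)
      also have "\<dots> = 0" using 2 by simp
      finally show ?thesis using 2 by auto
    qed
  next
    case perp
    define p where "p = (\<Sum>i\<in>I. y i * ?col i)"
    define t where "t = (\<Sum>i\<in>I. y i * b i) / p"
    have p: "p \<noteq> 0" using perp by (simp add: p_def)
    consider z where "?solves z (\<lambda>i. b i - t * ?col i)"
      | y' where "?perp y'" "(\<Sum>i\<in>I. y' i * (b i - t * ?col i)) \<noteq> 0"
      using insert.IH[of "\<lambda>i. b i - t * ?col i"] by auto
    then show ?thesis
    proof cases
      case 1
      then show ?thesis using extend by blast
    next
      case 2
      define s where "s = (\<Sum>i\<in>I. y' i * ?col i) / p"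
      have lin: "(\<Sum>i\<in>I. (y' i - s * y i) * g i) = (\<Sum>i\<in>I. y' i * g i) - s * (\<Sum>i\<in>I. y i * g i)"
        for g by (simp add: sum_distrib_left sum_subtractf algebra_simps)
      have "(\<Sum>i\<in>I. (y' i - s * y i) * ?col i) = 0"
        unfolding lin using p by (simp add: s_def flip: p_def)
      moreover have "(\<Sum>i\<in>I. (y' i - s * y i) * f i j) = 0" if "j \<in> J" for j
        unfolding lin using that 2 perp by simp
      moreover have "(\<Sum>i\<in>I. y' i * (b i - t * ?col i)) = (\<Sum>i\<in>I. (y' i - s * y i) * b i)"
      proof -
        have "(\<Sum>i\<in>I. y' i * (b i - t * ?col i)) = (\<Sum>i\<in>I. y' i * b i) - t * (\<Sum>i\<in>I. y' i * ?col i)"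
          by (simp add: sum_distrib_left sum_subtractf algebra_simps)
        also have "\<dots> = (\<Sum>i\<in>I. y' i * b i) - s * (\<Sum>i\<in>I. y i * b i)"
          by (simp add: s_def t_def)
        finally show ?thesis by (simp add: lin)
      qed
      ultimately show ?thesis using 2
        by (intro disjI2 exI[of _ "\<lambda>i. y' i - s * y i"]) auto
    qed
  qed
qed

section \<open>Bridges and two-colourings\<close>

definition symmetric_on :: "'a set \<Rightarrow> ('a \<Rightarrow> 'a \<Rightarrow> real) \<Rightarrow> bool" where
  "symmetric_on V W \<longleftrightarrow> (\<forall>a\<in>V. \<forall>b\<in>V. W a b = W b a)"

definition edge_set :: "('a \<Rightarrow> 'a \<Rightarrow> real) \<Rightarrow> 'a set \<Rightarrow> 'a set set" where
  "edge_set W V = {{a, b} | a b. a \<in> V \<and> b \<in> V \<and> W a b \<noteq> 0}"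

text \<open>
  Acyclicity of a finite graph, in the form that every edge \<open>e\<close> is a bridge: some vertex set \<open>C\<close> is left
  by \<open>e\<close> and by no other edge. In this form the property passes to subsets of the vertices without
  any discussion of paths or components, and restricting a vector to \<open>C\<close> isolates one edge.
\<close>

definition every_edge_is_cut :: "('a \<Rightarrow> 'a \<Rightarrow> real) \<Rightarrow> 'a set \<Rightarrow> bool" where
  "every_edge_is_cut W V \<longleftrightarrow> (\<forall>e\<in>edge_set W V. \<exists>C. \<forall>a\<in>V. \<forall>b\<in>V. W a b \<noteq> 0 \<longrightarrow>
     ((a \<in> C) \<noteq> (b \<in> C) \<longleftrightarrow> {a, b} = e))"

lemma every_edge_is_cut_subset:
  assumes "every_edge_is_cut W V" "U \<subseteq> V"
  shows "every_edge_is_cut W U"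
proof -
  have "edge_set W U \<subseteq> edge_set W V" using assms(2) by (auto simp: edge_set_def)
  then show ?thesis using assms unfolding every_edge_is_cut_def by (meson subsetD)
qed

text \<open>
  Choose for every edge \<open>e\<close> a set \<open>C e\<close> that only \<open>e\<close> leaves, and colour a vertex by the parity of the
  number of sets that contain it. The two ends of an edge \<open>e\<close> lie in the same sets except for \<open>C e\<close>,
  which contains exactly one of them.
\<close>

lemma every_edge_is_cut_two_colouring:
  assumes "every_edge_is_cut W V" "finite V"
  obtains c :: "'a \<Rightarrow> bool" where "\<And>a b. a \<in> V \<Longrightarrow> b \<in> V \<Longrightarrow> W a b \<noteq> 0 \<Longrightarrow> c a \<noteq> c b"
proof -
  obtain C where C: "\<And>e a b. e \<in> edge_set W V \<Longrightarrow> a \<in> V \<Longrightarrow> b \<in> V \<Longrightarrow> W a b \<noteq> 0 \<Longrightarrow>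
      (a \<in> C e) \<noteq> (b \<in> C e) \<longleftrightarrow> {a, b} = e"
    using assms(1) unfolding every_edge_is_cut_def by metis
  define D where "D a = {e \<in> edge_set W V. a \<in> C e}" for a
  have "edge_set W V \<subseteq> Pow V" by (auto simp: edge_set_def)
  then have fin: "finite (D a)" for a
    using assms(2) unfolding D_def by (auto intro: finite_subset)
  show thesis
  proof (rule that)
    fix a b assume ab: "a \<in> V" "b \<in> V" "W a b \<noteq> 0"
    let ?e = "{a, b}"
    have e: "?e \<in> edge_set W V" using ab by (auto simp: edge_set_def)
    have "D a - {?e} = D b - {?e}" and "?e \<in> D a \<longleftrightarrow> ?e \<notin> D b"
      using C[OF _ ab] e by (auto simp: D_def)
    then have "card (D a) = Suc (card (D b)) \<or> card (D b) = Suc (card (D a))"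
      using card_Suc_Diff1[OF fin, of ?e a] card_Suc_Diff1[OF fin, of ?e b] by (metis Diff_empty Diff_insert0)
    then show "even (card (D a)) \<noteq> even (card (D b))" by auto
  qed
qed

section \<open>Kernel vectors of forests and matchings\<close>

definition kernel_on :: "('a \<Rightarrow> 'a \<Rightarrow> real) \<Rightarrow> 'a set \<Rightarrow> ('a \<Rightarrow> real) \<Rightarrow> bool" where
  "kernel_on W V x \<longleftrightarrow> (\<forall>a\<in>V. (\<Sum>b\<in>V. W a b * x b) = 0)"

definition supported :: "('a \<Rightarrow> 'a \<Rightarrow> real) \<Rightarrow> 'a set \<Rightarrow> 'a \<Rightarrow> bool" where
  "supported W V u \<longleftrightarrow> (\<exists>x. kernel_on W V x \<and> x u \<noteq> 0)"

text \<open>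
  Let \<open>x\<close> be in the kernel on \<open>V\<close>, let \<open>y\<close> be in the kernel on \<open>V - {u}\<close>, and let \<open>C\<close> be the side of \<open>w\<close> of
  a set that only the edge \<open>uw\<close> leaves. Restricted to \<open>C\<close>, the vector \<open>y\<close> is still annihilated by all
  rows of \<open>V - {u}\<close>, and row \<open>u\<close> sends it to \<open>W u w * y w\<close>. Pairing it with \<open>W x = 0\<close> therefore
  gives \<open>W u w * y w * x u = 0\<close>.
\<close>

lemma supported_imp_neighbour_not_supported:
  assumes fin: "finite V" and sym: "symmetric_on V W" and cut: "every_edge_is_cut W V"
    and u: "u \<in> V" "supported W V u" and w: "w \<in> V - {u}" "W u w \<noteq> 0"
  shows "\<not> supported W (V - {u}) w"
proof
  assume "supported W (V - {u}) w"
  then obtain y where y: "\<And>a. a \<in> V - {u} \<Longrightarrow> (\<Sum>b\<in>V - {u}. W a b * y b) = 0" "y w \<noteq> 0"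
    by (auto simp: supported_def kernel_on_def)
  obtain x where x: "\<And>a. a \<in> V \<Longrightarrow> (\<Sum>b\<in>V. W a b * x b) = 0" "x u \<noteq> 0"
    using u by (auto simp: supported_def kernel_on_def)
  have "{u, w} \<in> edge_set W V" using u w by (auto simp: edge_set_def)
  then obtain C0 where C0: "\<And>a b. a \<in> V \<Longrightarrow> b \<in> V \<Longrightarrow> W a b \<noteq> 0 \<Longrightarrow>
      (a \<in> C0) \<noteq> (b \<in> C0) \<longleftrightarrow> {a, b} = {u, w}"
    using cut unfolding every_edge_is_cut_def by meson
  define C where "C = (if w \<in> C0 then V \<inter> C0 else V - C0)"
  have C: "(a \<in> C) \<noteq> (b \<in> C) \<longleftrightarrow> {a, b} = {u, w}" if "a \<in> V" "b \<in> V" "W a b \<noteq> 0" for a b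
    using C0[OF that] that by (auto simp: C_def)
  have wC: "w \<in> C" using w by (auto simp: C_def)
  then have uC: "u \<notin> C" using C[of u w] u w by auto
  have CV: "C \<subseteq> V - {u}" using uC by (auto simp: C_def split: if_splits)
  have col: "(\<Sum>a\<in>C. W a b * y a) = (if b = u then W u w * y w else 0)" if b: "b \<in> V" for b
  proof (cases "b \<in> C")
    case True
    have "(\<Sum>a\<in>C. W a b * y a) = (\<Sum>a\<in>V - {u}. W b a * y a)"
    proof (rule sum.mono_neutral_cong_left)
      show "\<forall>a\<in>V - {u} - C. W b a * y a = 0"
        using C[of b] True uC b by (fastforce simp: doubleton_eq_iff)
      show "W a b * y a = W b a * y a" if "a \<in> C" for a
        using that b CV sym by (auto simp: symmetric_on_def)
    qed (use fin CV in auto)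
    then show ?thesis using y(1)[of b] True CV uC by auto
  next
    case False
    have "W a b * y a = (if a = w then (if b = u then W u w * y w else 0) else 0)" if "a \<in> C" for a
      using that C[of a b] CV False b wC uC sym u w by (auto simp: doubleton_eq_iff symmetric_on_def)
    then have "(\<Sum>a\<in>C. W a b * y a)
        = (\<Sum>a\<in>C. if a = w then (if b = u then W u w * y w else 0) else 0)"
      by (intro sum.cong) auto
    then show ?thesis using wC finite_subset[OF CV] fin by simp
  qed
  have "0 = (\<Sum>a\<in>C. y a * (\<Sum>b\<in>V. W a b * x b))"
    using x(1) CV by (intro sum.neutral[symmetric]) auto
  also have "\<dots> = (\<Sum>b\<in>V. (\<Sum>a\<in>C. W a b * y a) * x b)"
    unfolding sum_distrib_left sum_distrib_right by (subst sum.swap) (simp add: mult_ac)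
  also have "\<dots> = (\<Sum>b\<in>V. if b = u then W u w * y w * x b else 0)"
    by (intro sum.cong) (auto simp: col)
  also have "\<dots> = W u w * y w * x u" using fin u by simp
  finally show False using w x y by simp
qed

text \<open>
  Every kernel vector on \<open>V - {u}\<close> vanishes at the neighbours of \<open>u\<close>, so it is orthogonal to the column
  of \<open>u\<close>, and that column is in the range of the symmetric matrix on \<open>V - {u}\<close>. A preimage \<open>z\<close> of its
  negative, extended by 1 at \<open>u\<close>, satisfies all equations except perhaps that of \<open>u\<close>. In a
  two-colouring the column lives on the colour opposite to \<open>u\<close>, so only the entries of \<open>z\<close> on the colour
  of \<open>u\<close> are needed; once the others are set to 0, the equation of \<open>u\<close> holds too.
\<close>

lemma no_neighbour_supported_imp_supported:
  assumes fin: "finite V" and sym: "symmetric_on V W" and cut: "every_edge_is_cut W V"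
    and u: "u \<in> V"
    and nbr: "\<And>w. w \<in> V - {u} \<Longrightarrow> W u w \<noteq> 0 \<Longrightarrow> \<not> supported W (V - {u}) w"
  shows "supported W V u"
proof -
  let ?U = "V - {u}"
  obtain c :: "'a \<Rightarrow> bool" where c: "\<And>a b. a \<in> V \<Longrightarrow> b \<in> V \<Longrightarrow> W a b \<noteq> 0 \<Longrightarrow> c a \<noteq> c b"
    using every_edge_is_cut_two_colouring[OF cut fin] by metis
  have "(\<Sum>i\<in>?U. y i * - W i u) = 0" if y: "\<forall>j\<in>?U. (\<Sum>i\<in>?U. y i * W i j) = 0" for y
  proof -
    have "kernel_on W ?U y" unfolding kernel_on_def
    proof
      fix a assume a: "a \<in> ?U"
      have "(\<Sum>b\<in>?U. W a b * y b) = (\<Sum>b\<in>?U. y b * W b a)"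
        using a sym by (intro sum.cong) (auto simp: symmetric_on_def)
      then show "(\<Sum>b\<in>?U. W a b * y b) = 0" using y a by simp
    qed
    then have "y w = 0" if "w \<in> ?U" "W u w \<noteq> 0" for w
      using nbr[OF that] by (auto simp: supported_def)
    then show ?thesis using sym u by (intro sum.neutral) (auto simp: symmetric_on_def)
  qed
  then obtain z where z: "\<And>a. a \<in> ?U \<Longrightarrow> (\<Sum>b\<in>?U. W a b * z b) = - W a u"
    using linear_system_alternative[of ?U ?U W "\<lambda>a. - W a u"] fin by auto
  define x where "x b = (if b = u then 1 else if c b = c u then z b else 0)" for b
  have row_split: "(\<Sum>b\<in>V. W a b * x b) = W a u + (\<Sum>b\<in>?U. W a b * x b)" for a
    using sum.remove[OF fin u, of "\<lambda>b. W a b * x b"] by (simp add: x_def)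
  have "(\<Sum>b\<in>V. W a b * x b) = 0" if a: "a \<in> V" for a
  proof (cases "c a = c u")
    case True
    then have "W a b * x b = 0" if "b \<in> V" for b
      using c[OF a that] c[OF a u] by (auto simp: x_def)
    then show ?thesis by (intro sum.neutral) blast
  next
    case False
    then have "W a b * x b = W a b * z b" if "b \<in> ?U" for b
      using c[OF a, of b] that by (auto simp: x_def)
    then have "(\<Sum>b\<in>?U. W a b * x b) = (\<Sum>b\<in>?U. W a b * z b)" by (intro sum.cong) auto
    moreover have "a \<in> ?U" using a False by auto
    ultimately show ?thesis using row_split[of a] z[of a] by linarith
  qed
  then show ?thesis unfolding supported_def kernel_on_def by (intro exI[of _ x]) (auto simp: x_def)
qed

definition matchings :: "('a \<Rightarrow> 'a \<Rightarrow> real) \<Rightarrow> 'a set \<Rightarrow> 'a set set set" where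
  "matchings W V = {M. M \<subseteq> edge_set W V \<and> (\<forall>e\<in>M. \<forall>f\<in>M. e \<noteq> f \<longrightarrow> e \<inter> f = {})}"

text \<open>
  For finite \<open>V\<close> this says that some maximum matching on \<open>V\<close> avoids \<open>u\<close>; comparing matchings avoids
  speaking of the matching number.
\<close>

definition exposable :: "('a \<Rightarrow> 'a \<Rightarrow> real) \<Rightarrow> 'a set \<Rightarrow> 'a \<Rightarrow> bool" where
  "exposable W V u \<longleftrightarrow> (\<forall>M\<in>matchings W V. \<exists>N\<in>matchings W (V - {u}). card M \<le> card N)"

lemma edge_set_Diff_singleton: "edge_set W (V - {u}) = {e \<in> edge_set W V. u \<notin> e}"
  by (auto simp: edge_set_def)

lemma matchingsI:
  assumes "\<And>e. e \<in> M \<Longrightarrow> e \<in> edge_set W V" "\<And>e f. e \<in> M \<Longrightarrow> f \<in> M \<Longrightarrow> e \<noteq> f \<Longrightarrow> e \<inter> f = {}"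
  shows "M \<in> matchings W V"
  using assms unfolding matchings_def by (simp add: subset_iff)

lemma matchingsD:
  assumes "M \<in> matchings W V"
  shows "e \<in> M \<Longrightarrow> e \<in> edge_set W V" "e \<in> M \<Longrightarrow> f \<in> M \<Longrightarrow> e \<noteq> f \<Longrightarrow> e \<inter> f = {}"
  using assms unfolding matchings_def by (simp_all add: subset_iff)

lemma matchings_insertI:
  assumes "e \<in> edge_set W V" "\<And>f. f \<in> M \<Longrightarrow> f \<inter> e = {}" "M \<in> matchings W V"
  shows "insert e M \<in> matchings W V"
proof (rule matchingsI)
  fix f g assume fg: "f \<in> insert e M" "g \<in> insert e M" "f \<noteq> g"
  then consider "f = e" "g \<in> M" | "f \<in> M" "g = e" | "f \<in> M" "g \<in> M" by blast
  then show "f \<inter> g = {}"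
  proof cases
    case 1
    then show ?thesis using assms(2)[of g] by (simp add: Int_commute)
  next
    case 2
    then show ?thesis using assms(2)[of f] by simp
  next
    case 3
    then show ?thesis using matchingsD(2)[OF assms(3)] fg(3) by simp
  qed
qed (use assms(1) matchingsD(1)[OF assms(3)] in blast)

lemma matchings_Diff_singletonI:
  assumes "M \<in> matchings W V" "\<And>e. e \<in> M \<Longrightarrow> u \<notin> e"
  shows "M \<in> matchings W (V - {u})"
  using assms by (simp add: matchings_def edge_set_Diff_singleton subset_iff)

lemma finite_matchings:
  assumes "finite V"
  shows "finite (matchings W V)" "M \<in> matchings W V \<Longrightarrow> finite M"
proof -
  have "edge_set W V \<subseteq> Pow V" by (auto simp: edge_set_def)
  then have fin: "finite (edge_set W V)" using assms by (auto intro: finite_subset)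
  show "finite (matchings W V)" unfolding matchings_def
    using fin by (auto intro: finite_subset[of _ "Pow (edge_set W V)"])
  show "finite M" if "M \<in> matchings W V"
    using that fin unfolding matchings_def by (auto intro: finite_subset)
qed

text \<open>
  If a maximum matching on \<open>V - {u}\<close> avoids the neighbour \<open>w\<close>, adding the edge \<open>uw\<close> beats every matching
  avoiding \<open>u\<close>. Conversely, let a matching contain \<open>uw\<close>, where every maximum matching on
  \<open>V - {u}\<close> covers \<open>w\<close>. The rest of the matching avoids \<open>w\<close>, so it is smaller than some
  matching on \<open>V - {u}\<close>, which is then at least as large as the whole matching.
\<close>

lemma exposable_iff_no_neighbour_exposable:
  assumes fin: "finite V" and sym: "symmetric_on V W" and u: "u \<in> V"
    and loop: "W u u = 0"
  shows "exposable W V u \<longleftrightarrow> (\<forall>w\<in>V - {u}. W u w \<noteq> 0 \<longrightarrow> \<not> exposable W (V - {u}) w)"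
proof (intro iffI ballI impI notI)
  fix w assume ex: "exposable W V u" and w: "w \<in> V - {u}" "W u w \<noteq> 0"
    and exw: "exposable W (V - {u}) w"
  let ?S = "card ` matchings W (V - {u})"
  have "{} \<in> matchings W (V - {u})" by (simp add: matchings_def)
  then have "?S \<noteq> {}" by blast
  moreover have S: "finite ?S" using finite_matchings(1)[of "V - {u}" W] fin by simp
  ultimately have "Max ?S \<in> ?S" using Max_in by blast
  then obtain N0 where N0: "Max ?S = card N0" "N0 \<in> matchings W (V - {u})" by (rule imageE)
  obtain N where N: "N \<in> matchings W (V - {u} - {w})" "card N0 \<le> card N"
    using exw[unfolded exposable_def, rule_format, OF N0(2)] by (rule bexE)
  have N_edge: "e \<in> edge_set W V \<and> u \<notin> e \<and> w \<notin> e" if "e \<in> N" for e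
    using matchingsD(1)[OF N(1) that] by (simp add: edge_set_Diff_singleton)
  have "{u, w} \<in> edge_set W V" using u w unfolding edge_set_def by blast
  moreover have "e \<inter> {u, w} = {}" if "e \<in> N" for e using N_edge[OF that] by simp
  moreover have "N \<in> matchings W V"
    using N_edge matchingsD(2)[OF N(1)] by (intro matchingsI) simp_all
  ultimately have "insert {u, w} N \<in> matchings W V" by (intro matchings_insertI)
  from ex[unfolded exposable_def, rule_format, OF this]
  obtain N' where N': "N' \<in> matchings W (V - {u})" "card (insert {u, w} N) \<le> card N'"
    by (rule bexE)
  have "{u, w} \<notin> N" using N_edge[of "{u, w}"] by blast
  then have "card (insert {u, w} N) = Suc (card N)"
    using finite_matchings(2)[OF _ N(1)] fin by simp
  moreover have "card N' \<le> card N0" unfolding N0(1)[symmetric] using S N'(1) by (intro Max_ge) simp_all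
  ultimately show False using N(2) N'(2) by linarith
next
  assume nbr: "\<forall>w\<in>V - {u}. W u w \<noteq> 0 \<longrightarrow> \<not> exposable W (V - {u}) w"
  have "\<exists>N\<in>matchings W (V - {u}). card M \<le> card N" if M: "M \<in> matchings W V" for M
  proof (cases "u \<in> \<Union>M")
    case False
    then have "u \<notin> e" if "e \<in> M" for e using that by blast
    then have "M \<in> matchings W (V - {u})" by (rule matchings_Diff_singletonI[OF M])
    then show ?thesis by (rule bexI[rotated]) simp
  next
    case True
    then obtain e where e: "e \<in> M" "u \<in> e" by (rule UnionE)
    obtain a b where ab: "e = {a, b}" "a \<in> V" "b \<in> V" "W a b \<noteq> 0"
      using matchingsD(1)[OF M e(1)] unfolding edge_set_def by blast
    have "W b a \<noteq> 0" using ab sym by (simp add: symmetric_on_def)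
    then obtain w where w: "e = {u, w}" "w \<in> V" "W u w \<noteq> 0" using ab e(2) by blast
    have "w \<noteq> u" using w(3) loop by blast
    let ?M = "M - {e}"
    have rest: "f \<in> edge_set W (V - {u} - {w})" if f: "f \<in> ?M" for f
    proof -
      have "f \<inter> {u, w} = {}" using matchingsD(2)[OF M, of f e] f e(1) w(1) by simp
      moreover have "f \<in> edge_set W V" using matchingsD(1)[OF M] f by simp
      ultimately show ?thesis by (simp add: edge_set_Diff_singleton)
    qed
    have M_rest: "?M \<in> matchings W (V - {u} - {w})"
      using rest matchingsD(2)[OF M] by (intro matchingsI) simp_all
    have "\<not> exposable W (V - {u}) w" using nbr w \<open>w \<noteq> u\<close> by blast
    then obtain N where N: "N \<in> matchings W (V - {u})"
      "\<forall>K\<in>matchings W (V - {u} - {w}). \<not> card N \<le> card K"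
      unfolding exposable_def by blast
    have "\<not> card N \<le> card ?M" by (rule bspec[OF N(2) M_rest])
    moreover have "card M = Suc (card ?M)"
      by (rule card_Suc_Diff1[OF finite_matchings(2)[OF fin M] e(1), symmetric])
    ultimately have "card M \<le> card N" by linarith
    then show ?thesis using N(1) by (rule bexI)
  qed
  then show "exposable W V u" unfolding exposable_def by (rule ballI)
qed

text \<open>
  In a forest both properties of \<open>u\<close> obey the same recursion: \<open>u\<close> has the property in \<open>V\<close> if and only
  if none of its neighbours has it in \<open>V - {u}\<close>.
\<close>

lemma supported_iff_exposable:
  assumes "finite V" "symmetric_on V W" "every_edge_is_cut W V" "\<And>a. a \<in> V \<Longrightarrow> W a a = 0" "u \<in> V"
  shows "supported W V u \<longleftrightarrow> exposable W V u"
  using assms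
proof (induction V arbitrary: u rule: finite_psubset_induct)
  case (psubset V)
  let ?U = "V - {u}"
  have sub: "?U \<subset> V" using psubset.prems by auto
  have "symmetric_on ?U W" using psubset.prems by (auto simp: symmetric_on_def)
  moreover have "every_edge_is_cut W ?U"
    using psubset.prems every_edge_is_cut_subset[of W V ?U] by blast
  ultimately have IH: "supported W ?U w \<longleftrightarrow> exposable W ?U w" if "w \<in> ?U" for w
    using psubset.IH[OF sub] psubset.prems that by blast
  have "supported W V u \<longleftrightarrow> (\<forall>w\<in>?U. W u w \<noteq> 0 \<longrightarrow> \<not> supported W ?U w)"
    using psubset supported_imp_neighbour_not_supported[of V W u]
      no_neighbour_supported_imp_supported[of V W u] by blast
  also have "\<dots> \<longleftrightarrow> exposable W V u"
    using IH exposable_iff_no_neighbour_exposable[of V W u] psubset by simp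
  finally show ?case .
qed


section \<open>Signed graphs and trees\<close>

definition weight :: "'a sgraph \<Rightarrow> 'a \<Rightarrow> 'a \<Rightarrow> real" where
  "weight \<Gamma> a b = (if adjacent \<Gamma> a b then sign_val (esign \<Gamma> {a, b}) else 0)"

lemma weight_eq_0_iff [simp]: "weight \<Gamma> a b = 0 \<longleftrightarrow> \<not> adjacent \<Gamma> a b"
  by (cases "esign \<Gamma> {a, b}") (auto simp: weight_def)

lemma signed_graphD:
  assumes "signed_graph \<Gamma>"
  shows "finite (vertices \<Gamma>)"
    and "adjacent \<Gamma> a b \<Longrightarrow> a \<in> vertices \<Gamma>" "adjacent \<Gamma> a b \<Longrightarrow> b \<in> vertices \<Gamma>"
    and "adjacent \<Gamma> a b \<Longrightarrow> adjacent \<Gamma> b a" "\<not> adjacent \<Gamma> a a"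
proof -
  interpret pair_graph "underlying \<Gamma>" using assms by (simp add: signed_graph_def)
  show "finite (vertices \<Gamma>)" by (rule pair_finite_verts)
  show "a \<in> vertices \<Gamma>" "b \<in> vertices \<Gamma>" if "adjacent \<Gamma> a b"
    using that in_arcsD1 in_arcsD2 by (auto simp: adjacent_def)
  show "adjacent \<Gamma> b a" if "adjacent \<Gamma> a b"
    using that arcs_symmetric by (auto simp: adjacent_def)
  show "\<not> adjacent \<Gamma> a a" using pair_no_loops[of "(a, a)"] by (auto simp: adjacent_def)
qed

lemma symmetric_on_weight:
  assumes "\<And>a b. a \<in> V \<Longrightarrow> b \<in> V \<Longrightarrow> adjacent \<Gamma> a b \<Longrightarrow> adjacent \<Gamma> b a"
  shows "symmetric_on V (weight \<Gamma>)"
  using assms by (auto simp: symmetric_on_def weight_def insert_commute)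

text \<open>
  The weights may be those of a larger graph: below, all graphs are compared with the joining graph
  that contains them.
\<close>

lemma nullity_eq_order_zero:
  assumes vs: "distinct vs" "set vs = vertices \<Gamma>"
    and sym: "symmetric_on (vertices \<Gamma>) W"
    and W: "\<And>a b. a \<in> vertices \<Gamma> \<Longrightarrow> b \<in> vertices \<Gamma> \<Longrightarrow> weight \<Gamma> a b = W a b"
  shows "nullity \<Gamma> = Polynomial.order 0 (char_poly (fun_mat W vs vs))"
proof -
  let ?ws = "vertex_list \<Gamma>"
  have ws: "distinct ?ws \<and> set ?ws = vertices \<Gamma>"
    unfolding vertex_list_def by (rule someI[of _ vs]) (use vs in simp)
  have "adj_matrix \<Gamma> ?ws = fun_mat (weight \<Gamma>) ?ws ?ws"
    by (simp add: adj_matrix_def fun_mat_def weight_def)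
  also have "\<dots> = fun_mat W ?ws ?ws" using ws W by (intro fun_mat_cong) auto
  finally show ?thesis unfolding nullity_def
    using order_zero_fun_mat_reorder[of vs ?ws W] vs ws sym by (simp add: symmetric_on_def)
qed

text \<open>
  For an edge \<open>uw\<close> take the vertices reachable from \<open>w\<close> without using that edge. If \<open>u\<close> were among them,
  a path from \<open>w\<close> to \<open>u\<close> without the edge would have at least two arcs and close up to a cycle of
  length at least 3.
\<close>

lemma signed_tree_every_edge_is_cut:
  assumes T: "signed_tree T"
  shows "every_edge_is_cut (weight T) (vertices T)"
  unfolding every_edge_is_cut_def
proof
  let ?G = "underlying T"
  have sg: "signed_graph T" using T by (simp add: signed_tree_def)
  interpret pair_graph ?G using sg by (simp add: signed_graph_def)
  fix e assume "e \<in> edge_set (weight T) (vertices T)"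
  then obtain u w where e: "e = {u, w}" and uw: "adjacent T u w" by (auto simp: edge_set_def)
  have ne: "u \<noteq> w" using uw signed_graphD(5)[OF sg] by auto
  define C where "C = {v. \<exists>p. awalk w p v \<and> (u, w) \<notin> set p \<and> (w, u) \<notin> set p}"
  have wC: "w \<in> C" using uw signed_graphD(3)[OF sg]
    by (auto simp: C_def awalk_Nil_iff intro: exI[of _ "[]"])
  have step: "b \<in> C" if a: "a \<in> C" and ab: "adjacent T a b" "{a, b} \<noteq> {u, w}" for a b
  proof -
    obtain p where p: "awalk w p a" "(u, w) \<notin> set p" "(w, u) \<notin> set p" 
      using a unfolding C_def by blast
    have "awalk a [(a, b)] b" using ab(1) signed_graphD(2,3)[OF sg ab(1)]
      by (auto simp: awalk_simps adjacent_def)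
    then have "awalk w (p @ [(a, b)]) b" using awalk_appendI[OF p(1)] by blast
    then show ?thesis using p ab(2) unfolding C_def by (intro CollectI exI[of _ "p @ [(a, b)]"]) auto
  qed
  have uC: "u \<notin> C"
  proof
    assume "u \<in> C"
    then obtain p where p: "awalk w p u" "(u, w) \<notin> set p" "(w, u) \<notin> set p" by (auto simp: C_def)
    define q where "q = awalk_to_apath p"
    have q: "apath w q u" "(w, u) \<notin> set q"
      using apath_awalk_to_apath[OF p(1)] awalk_to_apath_subset[OF p(1)] p by (auto simp: q_def)
    have aq: "awalk w q u" using q by (simp add: apath_def)
    have "awalk u ((u, w) # q) u"
      using uw aq signed_graphD(2)[OF sg uw] by (auto simp: awalk_Cons_iff adjacent_def)
    moreover have "distinct (tl (pawalk_verts u ((u, w) # q)))"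
      using q by (simp add: apath_def)
    ultimately have "cycle ((u, w) # q)" unfolding cycle_def by blast
    \<comment> \<open>A path of one arc from \<open>w\<close> to \<open>u\<close> is the excluded arc itself.\<close>
    moreover have "length ((u, w) # q) \<ge> 3"
    proof (cases q)
      case Nil
      then show ?thesis using aq ne by (simp add: awalk_Nil_iff)
    next
      case (Cons f r)
      then show ?thesis using aq q(2) by (cases r) (auto simp: awalk_simps)
    qed
    ultimately show False using T unfolding signed_tree_def by blast
  qed
  show "\<exists>C. \<forall>a\<in>vertices T. \<forall>b\<in>vertices T. weight T a b \<noteq> 0 \<longrightarrow> ((a \<in> C) \<noteq> (b \<in> C) \<longleftrightarrow> {a, b} = e)"
  proof (intro exI[of _ C] ballI impI)
    fix a b assume "weight T a b \<noteq> 0"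
    then have ab: "adjacent T a b" "adjacent T b a" using signed_graphD(4)[OF sg] by auto
    show "(a \<in> C) \<noteq> (b \<in> C) \<longleftrightarrow> {a, b} = e"
      using step[OF _ ab(1)] step[OF _ ab(2)] wC uC e by (auto simp: doubleton_eq_iff)
  qed
qed

lemma mismatched_imp_exposable:
  assumes T: "signed_graph T" and u: "mismatched T u"
  shows "exposable (weight T) (vertices T) u"
proof -
  have edges: "edge_set (weight T) (vertices T) = edges T"
    using signed_graphD(2,3)[OF T] unfolding edge_set_def edges_def weight_eq_0_iff not_not by blast
  then have matchings: "M \<in> matchings (weight T) (vertices T) \<longleftrightarrow> matching T M" for M
    by (auto simp: matchings_def matching_def)
  have max: "\<exists>M. maximum_matching T M \<and> u \<notin> \<Union>M"
  proof (cases "sg_order T = 1")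
    case True
    then obtain v where "vertices T = {v}" by (auto simp: sg_order_def card_1_singleton_iff)
    then have "\<not> adjacent T a b" for a b
      using signed_graphD(2,3)[OF T, of a b] signed_graphD(5)[OF T, of v] by auto
    then have "edges T = {}" by (auto simp: edges_def)
    then have "maximum_matching T {}" by (auto simp: maximum_matching_def matching_def)
    then show ?thesis by auto
  qed (use u in \<open>auto simp: mismatched_def\<close>)
  then obtain M where M: "maximum_matching T M" "u \<notin> \<Union>M" by (elim exE conjE)
  then have "M \<in> matchings (weight T) (vertices T)" by (simp add: matchings maximum_matching_def)
  then have "M \<in> matchings (weight T) (vertices T - {u})"
    by (rule matchings_Diff_singletonI) (use M(2) in blast)
  moreover have "card N \<le> card M" if "N \<in> matchings (weight T) (vertices T)" for N
    using that M(1) by (simp add: matchings maximum_matching_def)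
  ultimately show ?thesis unfolding exposable_def by (intro ballI bexI[of _ M])
qed

theorem theorem2p10:
  fixes T \<Gamma> \<Delta> :: "'a sgraph" and u :: 'a and n k :: nat
  assumes "signed_tree T"
    and "mismatched T u"
    and "signed_graph \<Gamma>"
    and "sg_order \<Gamma> = n"
    and "vertices T \<inter> vertices \<Gamma> = {}"
    and "1 \<le> k" and "k \<le> n"
    and "k_joining k T u \<Gamma> \<Delta>"
  shows "nullity \<Delta> = nullity (del_vertex T u) + nullity (induced \<Delta> (insert u (vertices \<Gamma>)))
    \<and> int (nullity (del_vertex T u) + nullity (induced \<Delta> (insert u (vertices \<Gamma>))))
        = int (nullity T) + int (nullity (induced \<Delta> (insert u (vertices \<Gamma>)))) - 1"
proof -
  let ?VT = "vertices T" and ?VG = "vertices \<Gamma>" and ?W = "weight \<Delta>"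
  let ?ord = "\<lambda>vs. Polynomial.order 0 (char_poly (fun_mat ?W vs vs))"
  have T: "signed_graph T" using assms(1) by (simp add: signed_tree_def)
  note G = assms(3)
  have u: "u \<in> ?VT" using assms(2) by (simp add: mismatched_def)
  obtain S where S: "S \<subseteq> ?VG" and V\<Delta>: "vertices \<Delta> = ?VT \<union> ?VG"
    and arcs: "parcs (underlying \<Delta>) = parcs (underlying T) \<union> parcs (underlying \<Gamma>) \<union> {u} \<times> S \<union> S \<times> {u}"
    and signT: "\<forall>e\<in>edges T. esign \<Delta> e = esign T e"
    using assms(8) unfolding k_joining_def by blast
  have adj: "adjacent \<Delta> a b \<longleftrightarrow> adjacent T a b \<or> adjacent \<Gamma> a b \<or> a = u \<and> b \<in> S \<or> a \<in> S \<and> b = u" for a b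
    using arcs by (auto simp: adjacent_def)
  have adjT: "adjacent \<Delta> a b \<longleftrightarrow> adjacent T a b" if "a \<in> ?VT" "b \<in> ?VT" for a b
    using that assms(5) S signed_graphD(2)[OF G] by (auto simp: adj)
  have sym: "symmetric_on V ?W" for V
    using signed_graphD(4)[OF T] signed_graphD(4)[OF G] by (intro symmetric_on_weight) (auto simp: adj)
  have WT: "weight T a b = ?W a b" if "a \<in> ?VT" "b \<in> ?VT" for a b
  proof (cases "adjacent T a b")
    case True
    then have "{a, b} \<in> edges T" unfolding edges_def by blast
    then show ?thesis using adjT[OF that] signT by (simp add: weight_def)
  qed (use adjT[OF that] in \<open>simp add: weight_def\<close>)
  have loop: "?W u u = 0"
    using signed_graphD(5)[OF T] adjT[OF u u] by simp

  obtain x where x: "\<And>a. a \<in> ?VT \<Longrightarrow> (\<Sum>b\<in>?VT. ?W a b * x b) = 0" "x u \<noteq> 0"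
  proof -
    have "symmetric_on ?VT (weight T)"
      using signed_graphD(4)[OF T] by (intro symmetric_on_weight)
    then have "supported (weight T) ?VT u"
      using supported_iff_exposable[of ?VT "weight T" u] signed_graphD(1,5)[OF T] u
        signed_tree_every_edge_is_cut[OF assms(1)] mismatched_imp_exposable[OF T assms(2)] by simp
    then obtain x where "kernel_on (weight T) ?VT x" "x u \<noteq> 0" by (auto simp: supported_def)
    then show thesis using that[of x] WT by (simp add: kernel_on_def)
  qed

  obtain ts where ts: "distinct ts" "set ts = ?VT - {u}"
    using finite_distinct_list[of "?VT - {u}"] signed_graphD(1)[OF T] by auto
  obtain gs where gs: "distinct gs" "set gs = ?VG"
    using finite_distinct_list[of ?VG] signed_graphD(1)[OF G] by auto
  have VT: "insert u (set ts) = ?VT" using ts u by auto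
  have uG: "u \<notin> ?VG" using u assms(5) by auto
  have cross: "?W a b = 0" if "a \<in> set ts" "b \<in> set gs" for a b
    proof -
    have "a \<in> ?VT" "a \<noteq> u" "b \<in> ?VG" using that ts gs by auto
    then have "b \<notin> ?VT" "a \<notin> ?VG" using assms(5) by auto
    then have "\<not> adjacent T a b" "\<not> adjacent \<Gamma> a b" "a \<notin> S"
      using S signed_graphD(3)[OF T, of a b] signed_graphD(2)[OF G, of a b] by auto
    then show ?thesis using \<open>a \<noteq> u\<close> by (simp add: adj)
  qed

  have dist: "distinct (ts @ u # gs)" "distinct (ts @ u # [])"
    using ts gs uG assms(5) by auto
  have sym': "?W a b = ?W b a" for a b using sym[of UNIV] by (simp add: symmetric_on_def)
  have ker: "(\<Sum>b\<in>insert u (set ts). ?W a b * x b) = 0" if "a \<in> insert u (set ts)" for a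
    using x(1) that unfolding VT .
  note split = order_zero_fun_mat_split_at_kernel_vector[where W = ?W and x = x, OF _ sym' loop _ ker x(2)]
  have "?ord (ts @ u # gs) = ?ord ts + ?ord (u # gs)"
    by (rule split[OF dist(1) cross])
  moreover have "nullity \<Delta> = ?ord (ts @ u # gs)"
  proof (rule nullity_eq_order_zero[OF dist(1) _ sym])
    show "set (ts @ u # gs) = vertices \<Delta>" unfolding V\<Delta> VT[symmetric] gs(2)[symmetric] by simp
  qed simp
  \<comment> \<open>The tree alone is the case of an empty second graph.\<close>
  moreover have "?ord (ts @ u # []) = ?ord ts + ?ord (u # [])"
    by (rule split[OF dist(2)]) simp
  moreover have "nullity T = ?ord (ts @ u # [])"
  proof (rule nullity_eq_order_zero[OF dist(2) _ sym WT])
    show "set (ts @ u # []) = vertices T" unfolding VT[symmetric] by simp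
  qed
  moreover have "?ord [u] = 1" by (rule order_zero_fun_mat_singleton[of ?W, OF loop])
  moreover have "nullity (del_vertex T u) = ?ord ts"
  proof (rule nullity_eq_order_zero[OF ts(1) _ sym])
    show "set ts = vertices (del_vertex T u)" using ts(2) by (simp add: del_vertex_def)
    fix a b assume "a \<in> vertices (del_vertex T u)" "b \<in> vertices (del_vertex T u)"
    then have ab: "a \<in> ?VT" "b \<in> ?VT" "a \<noteq> u" "b \<noteq> u" by (simp_all add: del_vertex_def)
    then have "weight (del_vertex T u) a b = weight T a b"
      by (simp add: del_vertex_def weight_def adjacent_def)
    then show "weight (del_vertex T u) a b = ?W a b" using WT[OF ab(1,2)] by simp
  qed
  moreover have "nullity (induced \<Delta> (insert u ?VG)) = ?ord (u # gs)"
  proof (rule nullity_eq_order_zero[OF _ _ sym])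
    show "distinct (u # gs)" using dist(1) by simp
    show "set (u # gs) = vertices (induced \<Delta> (insert u ?VG))"
      using u gs(2) V\<Delta> by (auto simp: induced_def)
    fix a b assume "a \<in> vertices (induced \<Delta> (insert u ?VG))" "b \<in> vertices (induced \<Delta> (insert u ?VG))"
    then have "a \<in> insert u ?VG" "b \<in> insert u ?VG" by (simp_all add: induced_def)
    then show "weight (induced \<Delta> (insert u ?VG)) a b = ?W a b"
      by (simp add: induced_def weight_def adjacent_def)
  qed
  ultimately show ?thesis by simp
qed

end
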